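(* Let $n\ge 1$ be an integer and $\alpha\ge 0$. Let $f=h+\overline{g}$ be a pluriharmonic mapping in the unit polydisk $\mathbb{P}\Delta(0;1)\subset\mathbb{C}^n$, where $h$ and $g$ are holomorphic in $\mathbb{P}\Delta(0;1)$ and $g(0)=0$. Then $f\in\mathcal{W}_{\mathcal{H}_n^0}(\alpha)$ if and only if the function $F_\varepsilon=h+\varepsilon g$ belongs to $\mathcal{W}_n(\alpha)$ for every $\varepsilon\in\mathbb{C}$ with $|\varepsilon|=1$.
   Context: $\mathbb{P}\Delta(0;1)=\{z=(z_1,\dots,z_n)\in\mathbb{C}^n: |z_i|<1,\ i=1,\dots,n\}$ is the unit polydisk. $\mathcal{H}_n$ is the class of complex-valued pluriharmonic functions $f$ in $\mathbb{P}\Delta(0;1)$ with $f(0)=0$ and $\frac{\partial f}{\partial z_j}(0)=1$ for $j=1,\dots,n$; every such $f$ is written $f=h+\overline{g}$ with $h,g$ holomorphic in $\mathbb{P}\Delta(0;1)$ and $h(0)=g(0)=0$. $\mathcal{H}_n^0$ is the subclass of $f\in\mathcal{H}_n$ with $\frac{\partial f}{\partial\overline{z}_j}(0)=0$ for all $j$. Thus for $f=h+\overline g\in\mathcal{H}_n^0$, in multi-index notation, $h(z)=\sum_{j=1}^n z_j+\sum_{k\ge2}\sum_{|\beta|=k}a_\beta z^\beta$ and $g(z)=\sum_{k\ge2}\sum_{|\beta|=k}b_\beta z^\beta$. $\mathcal{A}_n$ is the class of holomorphic functions $\phi$ in $\mathbb{P}\Delta(0;1)$ with $\phi(0)=0$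 and $\frac{\partial\phi}{\partial z_j}(0)=1$ for all $j$. For $\alpha\ge0$, $\mathcal{W}_{\mathcal{H}_n^0}(\alpha)$ is the class of all $f=h+\overline{g}\in\mathcal{H}_n^0$ such that for all $z\in\mathbb{P}\Delta(0;1)$ and all $j,k,l\in\{1,\dots,n\}$, $$\Re\left(\frac{\partial h(z)}{\partial z_k}+\alpha z_l\frac{\partial^2h(z)}{\partial z_j\partial z_k}\right)>\left|\frac{\partial g(z)}{\partial z_k}+\alpha z_l\frac{\partial^2g(z)}{\partial z_j\partial z_k}\right|.$$ $\mathcal{W}_n(\alpha)$ is the class of all $\phi\in\mathcal{A}_n$ such that for all $z\in\mathbb{P}\Delta(0;1)$ and all $j,k,l\in\{1,\dots,n\}$, $$\Re\left(\frac{\partial\phi(z)}{\partial z_k}+\alpha z_l\frac{\partial^2\phi(z)}{\partial z_j\partial z_k}\right)>0.$$ *)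

theory Defs
  imports "HOL-Complex_Analysis.Complex_Analysis"
begin

definition unit_polydisk :: "(complex ^ 'n) set" where
  "unit_polydisk = {z. \<forall>i. cmod (z $ i) < 1}"

text \<open>
  Wirtinger derivatives, with \<open>z\<^sub>j = x\<^sub>j + \<i> y\<^sub>j\<close>: \<open>wirtinger j f\<close> is
  \<open>\<partial>f/\<partial>z\<^sub>j = (\<partial>f/\<partial>x\<^sub>j - \<i> \<partial>f/\<partial>y\<^sub>j)/2\<close> and \<open>wirtinger_bar j f\<close> is the
  conjugate one. For holomorphic \<open>f\<close> the former is the ordinary complex partial
  derivative (lemma \<open>wirtinger_holomorphic\<close> below), so the same operator is used for
  pluriharmonic and for holomorphic functions.
\<close>

definition partial_x :: "'n \<Rightarrow> (complex ^ 'n \<Rightarrow> complex) \<Rightarrow> complex ^ 'n \<Rightarrow> complex" where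
  "partial_x j f z = vector_derivative (\<lambda>t::real. f (z + t *\<^sub>R axis j 1)) (at 0)"

definition partial_y :: "'n \<Rightarrow> (complex ^ 'n \<Rightarrow> complex) \<Rightarrow> complex ^ 'n \<Rightarrow> complex" where
  "partial_y j f z = vector_derivative (\<lambda>t::real. f (z + t *\<^sub>R axis j \<i>)) (at 0)"

definition wirtinger :: "'n \<Rightarrow> (complex ^ 'n \<Rightarrow> complex) \<Rightarrow> complex ^ 'n \<Rightarrow> complex" where
  "wirtinger j f z = (partial_x j f z - \<i> * partial_y j f z) / 2"

definition wirtinger_bar :: "'n \<Rightarrow> (complex ^ 'n \<Rightarrow> complex) \<Rightarrow> complex ^ 'n \<Rightarrow> complex" where
  "wirtinger_bar j f z = (partial_x j f z + \<i> * partial_y j f z) / 2"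

text \<open>
  The next three notions are meant for open \<open>S\<close>. Holomorphy in several variables is
  Frechet differentiability with a \<open>\<complex>\<close>-linear derivative; the operation \<open>*s\<close> is
  multiplication of a vector in \<open>\<complex>\<^sup>n\<close> by a complex scalar.
\<close>

definition holomorphic_cn_on :: "(complex ^ 'n \<Rightarrow> complex) \<Rightarrow> (complex ^ 'n) set \<Rightarrow> bool" where
  "holomorphic_cn_on f S \<longleftrightarrow>
    (\<forall>z\<in>S. \<exists>L. (f has_derivative L) (at z) \<and> (\<forall>c v. L (c *s v) = c * L v))"

text \<open>Twice continuously differentiable in the real sense.\<close>

definition C2_on :: "('a::real_normed_vector \<Rightarrow> 'b::real_normed_vector) \<Rightarrow> 'a set \<Rightarrow> bool" where
  "C2_on f S \<longleftrightarrow>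
    (\<exists>(f' :: 'a \<Rightarrow> 'a \<Rightarrow>\<^sub>L 'b) (f'' :: 'a \<Rightarrow> 'a \<Rightarrow>\<^sub>L 'a \<Rightarrow>\<^sub>L 'b).
      (\<forall>z\<in>S. (f has_derivative blinfun_apply (f' z)) (at z) \<and>
              (f' has_derivative blinfun_apply (f'' z)) (at z)) \<and>
      continuous_on S f'')"

definition pluriharmonic_on :: "(complex ^ 'n \<Rightarrow> complex) \<Rightarrow> (complex ^ 'n) set \<Rightarrow> bool" where
  "pluriharmonic_on f S \<longleftrightarrow>
    C2_on f S \<and> (\<forall>z\<in>S. \<forall>j k. wirtinger j (wirtinger_bar k f) z = 0)"

text \<open>
  In all classes below a function on the polydisk is a total function whose values
  outside the polydisk are irrelevant.
\<close>

definition class_H :: "(complex ^ 'n \<Rightarrow> complex) set" where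
  "class_H = {f. pluriharmonic_on f unit_polydisk \<and> f 0 = 0 \<and> (\<forall>j. wirtinger j f 0 = 1)}"

definition class_H0 :: "(complex ^ 'n \<Rightarrow> complex) set" where
  "class_H0 = {f \<in> class_H. \<forall>j. wirtinger_bar j f 0 = 0}"

definition class_A :: "(complex ^ 'n \<Rightarrow> complex) set" where
  "class_A = {\<phi>. holomorphic_cn_on \<phi> unit_polydisk \<and> \<phi> 0 = 0 \<and> (\<forall>j. wirtinger j \<phi> 0 = 1)}"

text \<open>
  The decomposition \<open>f = h + cnj g\<close> on the polydisk with \<open>h 0 = g 0 = 0\<close> is unique
  there, so the existential quantifier picks the decomposition of \<open>f\<close>.
\<close>

definition class_W_H0 :: "real \<Rightarrow> (complex ^ 'n \<Rightarrow> complex) set" where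
  "class_W_H0 \<alpha> = {f \<in> class_H0. \<exists>h g.
     holomorphic_cn_on h unit_polydisk \<and> holomorphic_cn_on g unit_polydisk \<and>
     h 0 = 0 \<and> g 0 = 0 \<and> (\<forall>z\<in>unit_polydisk. f z = h z + cnj (g z)) \<and>
     (\<forall>z\<in>unit_polydisk. \<forall>j k l.
        Re (wirtinger k h z + of_real \<alpha> * z $ l * wirtinger j (wirtinger k h) z)
        > cmod (wirtinger k g z + of_real \<alpha> * z $ l * wirtinger j (wirtinger k g) z))}"

definition class_W :: "real \<Rightarrow> (complex ^ 'n \<Rightarrow> complex) set" where
  "class_W \<alpha> = {\<phi> \<in> class_A. \<forall>z\<in>unit_polydisk. \<forall>j k l.
     Re (wirtinger k \<phi> z + of_real \<alpha> * z $ l * wirtinger j (wirtinger k \<phi>) z) > 0}"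

lemma wirtinger_holomorphic:
  fixes f :: "complex ^ 'n \<Rightarrow> complex"
  assumes "holomorphic_cn_on f S" "z \<in> S"
  shows "wirtinger j f z = deriv (\<lambda>w. f (z + axis j w)) 0"
proof -
  obtain L where L: "(f has_derivative L) (at z)" and lin: "\<And>c v. L (c *s v) = c * L v"
    using assms unfolding holomorphic_cn_on_def by blast
  have ax: "axis j w = w *s axis j 1" for w :: complex
    by (simp add: vec_eq_iff axis_def)
  have dir: "((\<lambda>t::real. f (z + t *\<^sub>R v)) has_vector_derivative L v) (at 0)" for v
  proof -
    have "((\<lambda>t::real. z + t *\<^sub>R v) has_derivative (\<lambda>t. t *\<^sub>R v)) (at 0)"
      by (auto intro!: derivative_eq_intros)
    from has_derivative_compose[OF this, of f L] L
    have "((\<lambda>t::real. f (z + t *\<^sub>R v)) has_derivative (\<lambda>t. L (t *\<^sub>R v))) (at 0)" by simp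
    then show ?thesis
      using linear_cmul[OF has_derivative_linear[OF L]] by (simp add: has_vector_derivative_def)
  qed
  have "bounded_linear (axis j :: complex \<Rightarrow> _)"
    by (rule linear_conv_bounded_linear[THEN iffD1], rule linearI)
      (auto simp: vec_eq_iff axis_def)
  then have "((\<lambda>w. z + axis j w) has_derivative axis j) (at 0)"
    by (auto intro!: derivative_eq_intros bounded_linear_imp_has_derivative)
  moreover have "z + axis j 0 = z" by simp
  ultimately have "((\<lambda>w. f (z + axis j w)) has_derivative (\<lambda>w. L (axis j w))) (at 0)"
    using has_derivative_compose[of "\<lambda>w. z + axis j w" "axis j" 0 UNIV f L] L by metis
  moreover have "(\<lambda>w. L (axis j w)) = (*) (L (axis j 1))"
    by (rule ext, subst ax, subst lin, simp)
  ultimately have "deriv (\<lambda>w. f (z + axis j w)) 0 = L (axis j 1)"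
    by (intro DERIV_imp_deriv) (simp add: has_field_derivative_def)
  moreover have "partial_x j f z = L (axis j 1)" "partial_y j f z = \<i> * L (axis j 1)"
    using dir[THEN vector_derivative_at] lin[of \<i> "axis j 1"] ax[of \<i>]
    by (simp_all add: partial_x_def partial_y_def)
  ultimately show ?thesis by (simp add: wirtinger_def)
qed

end

theory Submission
  imports Defs
begin

text \<open>
  Fix a point \<open>z\<close> and indices \<open>j, k, l\<close>, let \<open>A\<close> be \<open>\<partial>h/\<partial>z\<^sub>k + \<alpha> z\<^sub>l \<partial>\<^sup>2h/\<partial>z\<^sub>j\<partial>z\<^sub>k\<close> at \<open>z\<close>, and
  let \<open>B\<close> be the same expression in \<open>g\<close>. By linearity of the Wirtinger operators the
  expression for \<open>h + \<epsilon> g\<close> is \<open>A + \<epsilon> B\<close>, and the theorem reduces to a fact about two complex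
  numbers: \<open>cmod B < Re A\<close> iff \<open>Re (A + \<epsilon> B) > 0\<close> for all unimodular \<open>\<epsilon>\<close>, because the worst
  rotation turns \<open>B\<close> into \<open>- cmod B\<close> (lemma \<open>cmod_less_Re_iff_rotations\<close>). The normalisations
  at the origin match by the same linearity: \<open>\<partial>h/\<partial>z\<^sub>j + \<epsilon> \<partial>g/\<partial>z\<^sub>j = 1\<close> for \<open>\<epsilon> = 1\<close> and \<open>\<epsilon> = -1\<close>
  forces the two derivatives to be \<open>1\<close> and \<open>0\<close>.

  Two points need care. Membership of \<open>f\<close> in its class only says that some decomposition
  satisfies the inequality, not the given one. But in every decomposition the first
  derivatives of \<open>h\<close> and \<open>g\<close> are determined by those of \<open>f\<close> (lemmas \<open>wirtinger_decomposition\<close>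
  and \<open>wirtinger_bar_decomposition\<close>), hence so are \<open>A\<close> and \<open>B\<close>. Secondly, linearity of the
  second derivatives requires the first derivatives of \<open>h\<close> and \<open>g\<close> to be differentiable.
  By the same two lemmas this is inherited from \<open>f\<close>, which is twice continuously
  differentiable (lemmas \<open>C2_on_imp_wirtinger_differentiable\<close> and
  \<open>C2_on_imp_wirtinger_bar_differentiable\<close>), so Cauchy's integral formula is avoided.
\<close>

lemma open_unit_polydisk: "open (unit_polydisk :: (complex ^ 'n) set)"
proof -
  have "open (\<Inter>i. {z :: complex ^ 'n. cmod (z $ i) < 1})"
    by (intro open_INT ballI open_Collect_less continuous_intros finite)
  also have "(\<Inter>i. {z :: complex ^ 'n. cmod (z $ i) < 1}) = unit_polydisk"
    by (auto simp: unit_polydisk_def)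
  finally show ?thesis .
qed

lemma zero_in_unit_polydisk: "0 \<in> unit_polydisk"
  by (simp add: unit_polydisk_def)

lemma vector_derivative_along_line:
  assumes "(f has_derivative L) (at z)"
  shows "vector_derivative (\<lambda>t::real. f (z + t *\<^sub>R v)) (at 0) = L v"
proof -
  have "((\<lambda>t::real. z + t *\<^sub>R v) has_derivative (\<lambda>t. t *\<^sub>R v)) (at 0)"
    by (auto intro!: derivative_eq_intros)
  from has_derivative_compose[OF this, of f L] assms
  have "((\<lambda>t::real. f (z + t *\<^sub>R v)) has_derivative (\<lambda>t. L (t *\<^sub>R v))) (at 0)" by simp
  then have "((\<lambda>t::real. f (z + t *\<^sub>R v)) has_vector_derivative L v) (at 0)"
    using linear_cmul[OF has_derivative_linear[OF assms]] by (simp add: has_vector_derivative_def)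
  then show ?thesis by (rule vector_derivative_at)
qed

lemma wirtinger_eq:
  fixes f :: "complex ^ 'n \<Rightarrow> complex"
  assumes "(f has_derivative L) (at z)"
  shows "wirtinger j f z = (L (axis j 1) - \<i> * L (axis j \<i>)) / 2"
  using vector_derivative_along_line[OF assms]
  by (simp add: wirtinger_def partial_x_def partial_y_def)

lemma wirtinger_bar_eq:
  fixes f :: "complex ^ 'n \<Rightarrow> complex"
  assumes "(f has_derivative L) (at z)"
  shows "wirtinger_bar j f z = (L (axis j 1) + \<i> * L (axis j \<i>)) / 2"
  using vector_derivative_along_line[OF assms]
  by (simp add: wirtinger_bar_def partial_x_def partial_y_def)

lemma vector_derivative_line_cong:
  fixes f g :: "'a::real_normed_vector \<Rightarrow> 'b::real_normed_vector"
  assumes "open S" "z \<in> S" "\<And>w. w \<in> S \<Longrightarrow> f w = g w"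
  shows "vector_derivative (\<lambda>t::real. f (z + t *\<^sub>R v)) (at 0) =
         vector_derivative (\<lambda>t::real. g (z + t *\<^sub>R v)) (at 0)"
proof (rule vector_derivative_cong_eq)
  have "((\<lambda>t::real. z + t *\<^sub>R v) \<longlongrightarrow> z + 0 *\<^sub>R v) (nhds 0)"
    by (intro tendsto_intros filterlim_ident)
  then have "((\<lambda>t::real. z + t *\<^sub>R v) \<longlongrightarrow> z) (nhds 0)"
    by simp
  from topological_tendstoD[OF this assms(1,2)]
  have "\<forall>\<^sub>F t::real in nhds 0. z + t *\<^sub>R v \<in> S" .
  then show "\<forall>\<^sub>F t::real in nhds 0. t \<in> UNIV \<longrightarrow> f (z + t *\<^sub>R v) = g (z + t *\<^sub>R v)"
    by eventually_elim (use assms(3) in auto)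
qed auto

lemma wirtinger_cong:
  fixes f g :: "complex ^ 'n \<Rightarrow> complex"
  assumes "open S" "z \<in> S" "\<And>w. w \<in> S \<Longrightarrow> f w = g w"
  shows "wirtinger j f z = wirtinger j g z"
  using vector_derivative_line_cong[of S z f g, OF assms]
  by (simp add: wirtinger_def partial_x_def partial_y_def)

lemma wirtinger_add_cmult:
  fixes f g :: "complex ^ 'n \<Rightarrow> complex"
  assumes "f differentiable (at z)" "g differentiable (at z)"
  shows "wirtinger j (\<lambda>w. f w + c * g w) z = wirtinger j f z + c * wirtinger j g z"
proof -
  obtain F G where F: "(f has_derivative F) (at z)" and G: "(g has_derivative G) (at z)"
    using assms unfolding differentiable_def by blast
  have "((\<lambda>w. f w + c * g w) has_derivative (\<lambda>v. F v + c * G v)) (at z)"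
    by (intro derivative_intros F G)
  then show ?thesis
    by (simp add: wirtinger_eq[OF F] wirtinger_eq[OF G] wirtinger_eq field_simps)
qed

lemma holomorphic_cn_on_add_cmult:
  assumes "holomorphic_cn_on f S" "holomorphic_cn_on g S"
  shows "holomorphic_cn_on (\<lambda>w. f w + c * g w) S"
  unfolding holomorphic_cn_on_def
proof
  fix z assume "z \<in> S"
  with assms obtain F G where
    F: "(f has_derivative F) (at z)" "\<And>c v. F (c *s v) = c * F v" and
    G: "(g has_derivative G) (at z)" "\<And>c v. G (c *s v) = c * G v"
    unfolding holomorphic_cn_on_def by metis
  have "((\<lambda>w. f w + c * g w) has_derivative (\<lambda>v. F v + c * G v)) (at z)"
    by (intro derivative_intros F G)
  then show "\<exists>L. ((\<lambda>w. f w + c * g w) has_derivative L) (at z) \<and> (\<forall>c v. L (c *s v) = c * L v)"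
    by (intro exI conjI) (auto simp: F(2) G(2) algebra_simps)
qed

lemma differentiable_cong_open:
  assumes "f differentiable (at z)" "open S" "z \<in> S" "\<And>w. w \<in> S \<Longrightarrow> f w = g w"
  shows "g differentiable (at z)"
  using assms has_derivative_transform_within_open unfolding differentiable_def by blast

lemma holomorphic_cn_on_imp_differentiable:
  "holomorphic_cn_on f S \<Longrightarrow> z \<in> S \<Longrightarrow> f differentiable (at z)"
  unfolding holomorphic_cn_on_def differentiable_def by blast

text \<open>
  At a point the derivative of \<open>h + cnj g\<close> is the sum of a complex-linear and an antilinear
  map. The two Wirtinger operators extract these two parts, which is why they recover the
  derivatives of \<open>h\<close> and \<open>g\<close> from the sum.
\<close>
lemma
  fixes f h g :: "complex ^ 'n \<Rightarrow> complex"
  assumes "open S" "z \<in> S"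
    and "holomorphic_cn_on h S" "holomorphic_cn_on g S"
    and "\<And>w. w \<in> S \<Longrightarrow> f w = h w + cnj (g w)"
  shows wirtinger_decomposition: "wirtinger j h z = wirtinger j f z"
    and wirtinger_bar_decomposition: "wirtinger j g z = cnj (wirtinger_bar j f z)"
proof -
  obtain H G where
    H: "(h has_derivative H) (at z)" "\<And>c v. H (c *s v) = c * H v" and
    G: "(g has_derivative G) (at z)" "\<And>c v. G (c *s v) = c * G v"
    using assms(2-4) unfolding holomorphic_cn_on_def by metis
  have "((\<lambda>w. h w + cnj (g w)) has_derivative (\<lambda>v. H v + cnj (G v))) (at z)"
    by (intro derivative_intros H G)
  then have F: "(f has_derivative (\<lambda>v. H v + cnj (G v))) (at z)"
    by (rule has_derivative_transform_within_open[OF _ assms(1,2)]) (simp add: assms(5))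
  have ax: "axis j \<i> = \<i> *s (axis j 1 :: complex ^ 'n)"
    by (simp add: vec_eq_iff axis_def)
  show "wirtinger j h z = wirtinger j f z"
    unfolding wirtinger_eq[OF F] wirtinger_eq[OF H(1)] ax H(2) G(2)
    by (simp add: field_simps)
  show "wirtinger j g z = cnj (wirtinger_bar j f z)"
    unfolding wirtinger_bar_eq[OF F] wirtinger_eq[OF G(1)] ax H(2) G(2)
    by (simp add: field_simps)
qed

lemma
  fixes f :: "complex ^ 'n \<Rightarrow> complex"
  assumes "C2_on f S" "open S" "z \<in> S"
  shows C2_on_imp_wirtinger_differentiable: "wirtinger k f differentiable (at z)"
    and C2_on_imp_wirtinger_bar_differentiable: "wirtinger_bar k f differentiable (at z)"
proof -
  obtain f' :: "complex ^ 'n \<Rightarrow> (complex ^ 'n) \<Rightarrow>\<^sub>L complex"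
    and f'' :: "complex ^ 'n \<Rightarrow> (complex ^ 'n) \<Rightarrow>\<^sub>L (complex ^ 'n) \<Rightarrow>\<^sub>L complex" where
    f': "\<And>w. w \<in> S \<Longrightarrow> (f has_derivative blinfun_apply (f' w)) (at w)" and
    f'': "\<And>w. w \<in> S \<Longrightarrow> (f' has_derivative blinfun_apply (f'' w)) (at w)"
    using assms(1) unfolding C2_on_def by metis
  have "(\<lambda>w. f' w v) differentiable (at z)" for v
    using bounded_linear.has_derivative[OF blinfun.bounded_linear_left[of v] f''[OF assms(3)]]
    unfolding differentiable_def by blast
  then have ap: "(\<lambda>w. (f' w (axis k 1) - \<i> * f' w (axis k \<i>)) / 2) differentiable (at z)"
    "(\<lambda>w. (f' w (axis k 1) + \<i> * f' w (axis k \<i>)) / 2) differentiable (at z)"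
    by (auto intro!: derivative_intros)
  show "wirtinger k f differentiable (at z)"
    by (rule differentiable_cong_open[OF ap(1) assms(2,3)])
      (simp add: wirtinger_eq[OF f'])
  show "wirtinger_bar k f differentiable (at z)"
    by (rule differentiable_cong_open[OF ap(2) assms(2,3)])
      (simp add: wirtinger_bar_eq[OF f'])
qed

text \<open>
  The bound \<open>- cmod B\<close> for \<open>Re (\<epsilon> B)\<close> gives one direction; that some unimodular \<open>\<epsilon>\<close> attains it
  gives the other.
\<close>
lemma cmod_less_Re_iff_rotations:
  "cmod B < Re A \<longleftrightarrow> (\<forall>\<epsilon>. cmod \<epsilon> = 1 \<longrightarrow> 0 < Re (A + \<epsilon> * B))"
proof
  assume less: "cmod B < Re A"
  show "\<forall>\<epsilon>. cmod \<epsilon> = 1 \<longrightarrow> 0 < Re (A + \<epsilon> * B)"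
  proof (intro allI impI)
    fix \<epsilon> :: complex assume "cmod \<epsilon> = 1"
    then have "\<bar>Re (\<epsilon> * B)\<bar> \<le> cmod B"
      using abs_Re_le_cmod[of "\<epsilon> * B"] by (simp add: norm_mult)
    with less show "0 < Re (A + \<epsilon> * B)" by simp
  qed
next
  assume rot: "\<forall>\<epsilon>. cmod \<epsilon> = 1 \<longrightarrow> 0 < Re (A + \<epsilon> * B)"
  show "cmod B < Re A"
  proof (cases "B = 0")
    case True
    then show ?thesis using rot[rule_format, of 1] by simp
  next
    case False
    define \<epsilon> where "\<epsilon> = - cnj (sgn B)"
    have "\<epsilon> * B = - of_real (cmod B)"
      using False complex_norm_square[of B]
      by (simp add: \<epsilon>_def sgn_eq field_simps power2_eq_square)
    moreover have "cmod \<epsilon> = 1"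
      using False by (simp add: \<epsilon>_def norm_sgn)
    ultimately show ?thesis using rot[rule_format, of \<epsilon>] by simp
  qed
qed

theorem theorem3p1:
  fixes f h g :: "complex ^ 'n \<Rightarrow> complex" and \<alpha> :: real
  assumes "\<alpha> \<ge> 0"
    and "pluriharmonic_on f unit_polydisk"
    and "holomorphic_cn_on h unit_polydisk"
    and "holomorphic_cn_on g unit_polydisk"
    and "\<forall>z\<in>unit_polydisk. f z = h z + cnj (g z)"
    and "g 0 = 0"
  shows "f \<in> class_W_H0 \<alpha> \<longleftrightarrow>
    (\<forall>\<epsilon>::complex. cmod \<epsilon> = 1 \<longrightarrow> (\<lambda>z. h z + \<epsilon> * g z) \<in> class_W \<alpha>)"
proof -
  let ?D = "unit_polydisk :: (complex ^ 'n) set"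
  note opn = open_unit_polydisk
  \<comment> \<open>The inequalities in both classes compare values of this one linear operator.\<close>
  define T where "T \<phi> j k l z = wirtinger k \<phi> z + of_real \<alpha> * z $ l * wirtinger j (wirtinger k \<phi>) z"
    for \<phi> :: "complex ^ 'n \<Rightarrow> complex" and j k l z
  have C2: "C2_on f ?D"
    using assms(2) by (simp add: pluriharmonic_on_def)
  have dh: "wirtinger k h z = wirtinger k f z"
    and dg: "wirtinger k g z = cnj (wirtinger_bar k f z)" if "z \<in> ?D" for z k
    using wirtinger_decomposition[OF opn that assms(3,4), of f]
      wirtinger_bar_decomposition[OF opn that assms(3,4), of f] assms(5) by auto

  have diff_h: "wirtinger k h differentiable (at z)" if "z \<in> ?D" for z k
    by (rule differentiable_cong_open
        [OF C2_on_imp_wirtinger_differentiable[OF C2 opn that] opn that]) (simp add: dh)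
  have diff_g: "wirtinger k g differentiable (at z)" if "z \<in> ?D" for z k
  proof -
    have "(\<lambda>w. cnj (wirtinger_bar k f w)) differentiable (at z)"
      using C2_on_imp_wirtinger_bar_differentiable[OF C2 opn that]
      unfolding differentiable_def by (blast intro: has_derivative_cnj)
    then show ?thesis
      by (rule differentiable_cong_open[OF _ opn that]) (simp add: dg)
  qed
  have d1: "wirtinger k (\<lambda>w. h w + \<epsilon> * g w) z = wirtinger k h z + \<epsilon> * wirtinger k g z"
    if "z \<in> ?D" for z k \<epsilon>
    using that assms(3,4) by (intro wirtinger_add_cmult holomorphic_cn_on_imp_differentiable)
  have T_add: "T (\<lambda>w. h w + \<epsilon> * g w) j k l z = T h j k l z + \<epsilon> * T g j k l z"
    if "z \<in> ?D" for z j k l \<epsilon>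
  proof -
    have "wirtinger j (wirtinger k (\<lambda>w. h w + \<epsilon> * g w)) z
        = wirtinger j (\<lambda>w. wirtinger k h w + \<epsilon> * wirtinger k g w) z"
      using d1 by (rule wirtinger_cong[OF opn that])
    also have "\<dots> = wirtinger j (wirtinger k h) z + \<epsilon> * wirtinger j (wirtinger k g) z"
      using diff_h[OF that] diff_g[OF that] by (rule wirtinger_add_cmult)
    finally show ?thesis
      by (simp add: T_def d1[OF that] algebra_simps)
  qed

  have f0: "f 0 = h 0"
    using assms(5,6) zero_in_unit_polydisk by force
  have H0: "f \<in> class_H0 \<longleftrightarrow>
      h 0 = 0 \<and> (\<forall>j. wirtinger j h 0 = 1) \<and> (\<forall>j. wirtinger j g 0 = 0)"
    using assms(2) f0
    by (auto simp: class_H0_def class_H_def dh[OF zero_in_unit_polydisk] dg[OF zero_in_unit_polydisk])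

  have W_H0: "f \<in> class_W_H0 \<alpha> \<longleftrightarrow>
      f \<in> class_H0 \<and> (\<forall>z\<in>?D. \<forall>j k l. cmod (T g j k l z) < Re (T h j k l z))" (is "_ \<longleftrightarrow> ?R")
  proof
    assume "f \<in> class_W_H0 \<alpha>"
    then obtain h1 g1 where f: "f \<in> class_H0"
      and hol: "holomorphic_cn_on h1 ?D" "holomorphic_cn_on g1 ?D"
      and eq: "\<forall>z\<in>?D. f z = h1 z + cnj (g1 z)"
      and ineq: "\<forall>z\<in>?D. \<forall>j k l. cmod (T g1 j k l z) < Re (T h1 j k l z)"
      unfolding class_W_H0_def T_def by blast
    have d: "wirtinger k h1 z = wirtinger k h z" "wirtinger k g1 z = wirtinger k g z"
      if "z \<in> ?D" for z k
      \<comment> \<open>Both decompositions have the derivatives read off from \<open>f\<close>.\<close>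
      using wirtinger_decomposition[OF opn that hol, of f]
        wirtinger_bar_decomposition[OF opn that hol, of f]
        eq dh[OF that] dg[OF that] by auto
    have "T h1 j k l z = T h j k l z" "T g1 j k l z = T g j k l z" if "z \<in> ?D" for z j k l
      using wirtinger_cong[OF opn that d(1)] wirtinger_cong[OF opn that d(2)] d[OF that]
      by (simp_all add: T_def)
    with f ineq show ?R by simp
  next
    assume R: ?R
    then show "f \<in> class_W_H0 \<alpha>"
      using assms(3-6) H0 unfolding class_W_H0_def T_def by blast
  qed

  have A: "(\<lambda>z. h z + \<epsilon> * g z) \<in> class_A \<longleftrightarrow>
      h 0 = 0 \<and> (\<forall>j. wirtinger j h 0 + \<epsilon> * wirtinger j g 0 = 1)" for \<epsilon>
    using assms(6) holomorphic_cn_on_add_cmult[OF assms(3,4)]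
    by (simp add: class_A_def d1[OF zero_in_unit_polydisk])
  have H0_A: "f \<in> class_H0 \<longleftrightarrow> (\<forall>\<epsilon>. cmod \<epsilon> = 1 \<longrightarrow> (\<lambda>z. h z + \<epsilon> * g z) \<in> class_A)"
  proof
    assume "f \<in> class_H0"
    then show "\<forall>\<epsilon>. cmod \<epsilon> = 1 \<longrightarrow> (\<lambda>z. h z + \<epsilon> * g z) \<in> class_A"
      by (simp add: H0 A)
  next
    assume all: "\<forall>\<epsilon>. cmod \<epsilon> = 1 \<longrightarrow> (\<lambda>z. h z + \<epsilon> * g z) \<in> class_A"
    have "h 0 = 0" and plus: "wirtinger j h 0 + wirtinger j g 0 = 1"
      and minus: "wirtinger j h 0 - wirtinger j g 0 = 1" for j
      using all[rule_format, of 1, unfolded A] all[rule_format, of "-1", unfolded A] by simp_all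
    moreover have "wirtinger j h 0 = 1 \<and> wirtinger j g 0 = 0" for j
      using plus[of j] minus[of j] by (simp add: complex_eq_iff)
    ultimately show "f \<in> class_H0"
      by (simp add: H0)
  qed

  have W: "(\<lambda>z. h z + \<epsilon> * g z) \<in> class_W \<alpha> \<longleftrightarrow> (\<lambda>z. h z + \<epsilon> * g z) \<in> class_A \<and>
      (\<forall>z\<in>?D. \<forall>j k l. 0 < Re (T h j k l z + \<epsilon> * T g j k l z))" for \<epsilon>
    by (simp add: class_W_def T_add del: plus_complex.sel times_complex.sel flip: T_def)
  show ?thesis
    unfolding W_H0 W H0_A cmod_less_Re_iff_rotations by blast
qed

end
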